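(* Let $\boldsymbol u^{\mathrm{low}},\boldsymbol u^{\mathrm{upp}}\in\mathbb R^{N_1\times N_2\times K}$ with $\boldsymbol u^{\mathrm{low}}\le\boldsymbol u^{\mathrm{upp}}$ entrywise, let $\boldsymbol A=\tilde{\boldsymbol\nabla}_{\boldsymbol x,t}\tilde{\boldsymbol\Delta}:\mathbb R^{N_1\times N_2\times K}\to\mathbb R^{N_1\times N_2\times K\times 3}$ be the linear operator defined in the context, let $\mu>0$, and define the Huber loss function $$h_\mu:\mathbb R^3\to\mathbb R,\qquad h_\mu(\boldsymbol v):=\begin{cases}\|\boldsymbol v\|-\frac\mu2,&\text{if }\|\boldsymbol v\|\ge\mu,\\ \frac{\|\boldsymbol v\|^2}{2\mu},&\text{otherwise.}\end{cases}$$ Then the Nesterov smoothing with parameter $\mu$ of the TV-ULoG optimization problem $$\min_{\boldsymbol u\in\mathbb R^{N_1\times N_2\times K}}\ \sum_{i,j,k}\|(\boldsymbol A\boldsymbol u)_{i,j,k}\|\quad\text{s.t.}\quad\boldsymbol u^{\mathrm{low}}\le\boldsymbol u\le\boldsymbol u^{\mathrm{upp}}$$ is $$\min_{\boldsymbol u\in\mathbb R^{N_1\times N_2\times K}}\ \sum_{i,j,k}h_\mu\big((\boldsymbol A\boldsymbol u)_{i,j,k}\big)\quad\text{s.t.}\quad\boldsymbol u^{\mathrm{low}}\le\boldsymbol u\le\boldsymbol u^{\mathrm{upp}}.$$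
   Context: Notation: $\|\cdot\|$ is the Euclidean norm and $\langle\cdot,\cdot\rangle$ the Euclidean (entrywise) inner product; for $\boldsymbol v\in\mathbb R^{N_1\times N_2\times K\times 3}$, $\boldsymbol v_{i,j,k}\in\mathbb R^3$. Inequalities between arrays are entrywise, and $[\boldsymbol u^{\mathrm{low}},\boldsymbol u^{\mathrm{upp}}]$ is the set of arrays $\boldsymbol u$ with $\boldsymbol u^{\mathrm{low}}\le\boldsymbol u\le\boldsymbol u^{\mathrm{upp}}$. Nesterov smoothing: for a problem $\min_{\boldsymbol u\in C_1}\phi(\boldsymbol u)$ with $\phi(\boldsymbol u)=\max_{\boldsymbol w\in C_2}\langle\boldsymbol B\boldsymbol u,\boldsymbol w\rangle$, where $\boldsymbol B$ is linear and $C_1,C_2$ are bounded closed convex sets, its Nesterov smoothing with parameter $\mu>0$ is the problem $\min_{\boldsymbol u\in C_1}\phi_\mu(\boldsymbol u)$ with $$\phi_\mu(\boldsymbol u):=\max_{\boldsymbol w\in C_2}\Big\{\langle\boldsymbol B\boldsymbol u,\boldsymbol w\rangle-\frac\mu2\|\boldsymbol w\|^2\Big\}.$$ The TV-ULoG problem is regarded as being of this form with $C_1=[\boldsymbol u^{\mathrm{low}},\boldsymbol u^{\mathrm{upp}}]$, $\boldsymbol B=\boldsymbol A$ and $C_2=\{\boldsymbol w\in\mathbb R^{N_1\times N_2\times K\times 3}:\|\boldsymbol w_{i,j,k}\|\le1\text{ for all }i,j,k\}$. Definition of $\boldsymbol A$: $N_1,N_2\ge 2$, $K\ge1$ are integers,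 $h_1,h_2>0$ grid sizes, $0<t_1<\dots<t_K$ with $t_{k+1}=bt_k$ for a fixed $b>1$. The discrete scale-normalized Laplacian $\tilde{\boldsymbol\Delta}:\mathbb R^{N_1\times N_2\times K}\to\mathbb R^{N_1\times N_2\times K}$ is $$(\tilde{\boldsymbol\Delta}\boldsymbol u)_{i,j,k}=t_k\Big(\tfrac{u_{i+1,j,k}-2u_{i,j,k}+u_{i-1,j,k}}{h_1^2}+\tfrac{u_{i,j+1,k}-2u_{i,j,k}+u_{i,j-1,k}}{h_2^2}\Big),$$ with the conventions $u_{0,j,k}:=u_{2,j,k}$, $u_{N_1+1,j,k}:=u_{N_1-1,j,k}$, $u_{i,0,k}:=u_{i,2,k}$, $u_{i,N_2+1,k}:=u_{i,N_2-1,k}$. The discrete scale-space gradient $\tilde{\boldsymbol\nabla}_{\boldsymbol x,t}:\mathbb R^{N_1\times N_2\times K}\to\mathbb R^{N_1\times N_2\times K\times 3}$ has as $(i,j,k)$ component the vector in $\mathbb R^3$ with entries $$t_k^{1/2}\tfrac{u_{i+1,j,k}-u_{i,j,k}}{h_1},\qquad t_k^{1/2}\tfrac{u_{i,j+1,k}-u_{i,j,k}}{h_2},\qquad \tfrac{1}{b-1}(u_{i,j,k+1}-u_{i,j,k}),$$ with the conventions (for this operator) $u_{N_1+1,j,k}:=u_{N_1,j,k}$, $u_{i,N_2+1,k}:=u_{i,N_2,k}$, $u_{i,j,K+1}:=u_{i,j,K}$. *)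

theory Defs
  imports "HOL-Analysis.Analysis"
begin

text \<open>
  An array in \<open>\<real>\<^bsup>N\<^sub>1\<times>N\<^sub>2\<times>K\<^esup>\<close> is an element of type \<open>('n1, 'n2, 'k) scalar_array\<close> with
  \<open>N\<^sub>1 = CARD('n1)\<close>, \<open>N\<^sub>2 = CARD('n2)\<close>, \<open>K = CARD('k)\<close>, and its entry \<open>u\<^sub>i\<^sub>j\<^sub>k\<close> is \<open>u $ i $ j $ k\<close>. The
  library's norm, inner product and order on this type are the Euclidean norm, the entrywise
  inner product and the entrywise order. The index types are linearly ordered, so that an index
  is identified with its 1-based position in \<open>{1..N}\<close>.
\<close>

type_synonym ('n1, 'n2, 'k) scalar_array = "(((real, 'k) vec, 'n2) vec, 'n1) vec"
type_synonym ('n1, 'n2, 'k) vector_array = "((((real, 3) vec, 'k) vec, 'n2) vec, 'n1) vec"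

definition position :: "'n::{finite,linorder} \<Rightarrow> nat" where
  "position i = card {..i}"

definition index_at :: "nat \<Rightarrow> 'n::{finite,linorder}" where
  "index_at m = (THE i. position i = m)"

lemma inj_position: "inj (position :: 'n::{finite,linorder} \<Rightarrow> nat)"
proof (rule injI)
  fix i j :: 'n
  assume eq: "position i = position j"
  have *: "position x < position y" if "x < y" for x y :: 'n
    unfolding position_def by (rule psubset_card_mono) (use that in auto)
  show "i = j"
    using eq *[of i j] *[of j i] by (cases i j rule: linorder_cases) auto
qed

lemma index_at_position [simp]: "index_at (position i) = i"
  unfolding index_at_def using inj_position by (auto dest: injD)

lemma bij_betw_position:
  "bij_betw (position :: 'n::{finite,linorder} \<Rightarrow> nat) UNIV {1..CARD('n)}"
proof -
  have sub: "range (position :: 'n \<Rightarrow> nat) \<subseteq> {1..CARD('n)}"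
  proof
    fix m assume "m \<in> range (position :: 'n \<Rightarrow> nat)"
    then obtain i :: 'n where m: "m = card {..i}" by (auto simp: position_def)
    have "card {..i} \<le> CARD('n)" by (rule card_mono) auto
    moreover have "card {..i} > 0" by (auto simp: card_gt_0_iff)
    ultimately show "m \<in> {1..CARD('n)}" using m by auto
  qed
  have "card (range (position :: 'n \<Rightarrow> nat)) = card {1..CARD('n)}"
    by (simp add: card_image inj_position)
  with sub have "range (position :: 'n \<Rightarrow> nat) = {1..CARD('n)}"
    by (intro card_subset_eq) auto
  then show ?thesis using inj_position by (simp add: bij_betw_def)
qed

text \<open>The conventions \<open>u\<^sub>0 = u\<^sub>2\<close> and \<open>u\<^bsub>N+1\<^esub> = u\<^bsub>N-1\<^esub>\<close> as a map on positions.\<close>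

definition reflect :: "nat \<Rightarrow> nat \<Rightarrow> nat" where
  "reflect N m = (if m = 0 then 2 else if m = N + 1 then N - 1 else m)"

text \<open>The convention \<open>u\<^bsub>N+1\<^esub> = u\<^sub>N\<close>.\<close>

definition replicate_last :: "nat \<Rightarrow> nat \<Rightarrow> nat" where
  "replicate_last N m = (if m = N + 1 then N else m)"

definition scale_laplacian ::
  "real \<Rightarrow> real \<Rightarrow> (nat \<Rightarrow> real) \<Rightarrow>
   ('n1::{finite,linorder}, 'n2::{finite,linorder}, 'k::{finite,linorder}) scalar_array \<Rightarrow>
   ('n1, 'n2, 'k) scalar_array" where
  "scale_laplacian h1 h2 t u = (\<chi> i j k.
     let p = position i; q = position j;
         U = (\<lambda>p q. u $ index_at (reflect CARD('n1) p) $ index_at (reflect CARD('n2) q) $ k)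
     in t (position k) *
        ((U (p + 1) q - 2 * U p q + U (p - 1) q) / h1\<^sup>2 +
         (U p (q + 1) - 2 * U p q + U p (q - 1)) / h2\<^sup>2))"

definition scale_gradient ::
  "real \<Rightarrow> real \<Rightarrow> real \<Rightarrow> (nat \<Rightarrow> real) \<Rightarrow>
   ('n1::{finite,linorder}, 'n2::{finite,linorder}, 'k::{finite,linorder}) scalar_array \<Rightarrow>
   ('n1, 'n2, 'k) vector_array" where
  "scale_gradient h1 h2 b t u = (\<chi> i j k.
     let p = position i; q = position j; r = position k;
         U = (\<lambda>p q r. u $ index_at (replicate_last CARD('n1) p)
                       $ index_at (replicate_last CARD('n2) q)
                       $ index_at (replicate_last CARD('k) r))
     in vector [sqrt (t r) * ((U (p + 1) q r - U p q r) / h1),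
                sqrt (t r) * ((U p (q + 1) r - U p q r) / h2),
                1 / (b - 1) * (U p q (r + 1) - U p q r)])"

definition ulog_op ::
  "real \<Rightarrow> real \<Rightarrow> real \<Rightarrow> (nat \<Rightarrow> real) \<Rightarrow>
   ('n1::{finite,linorder}, 'n2::{finite,linorder}, 'k::{finite,linorder}) scalar_array \<Rightarrow>
   ('n1, 'n2, 'k) vector_array" where
  "ulog_op h1 h2 b t u = scale_gradient h1 h2 b t (scale_laplacian h1 h2 t u)"

datatype 'a min_problem = Minimize (objective: "'a \<Rightarrow> real") (feasible: "'a set")

definition is_maximum :: "real \<Rightarrow> ('a \<Rightarrow> real) \<Rightarrow> 'a set \<Rightarrow> bool" where
  "is_maximum y f S \<longleftrightarrow> (\<exists>x\<in>S. f x = y) \<and> (\<forall>x\<in>S. f x \<le> y)"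

definition max_form ::
  "('a::euclidean_space \<Rightarrow> 'b::euclidean_space) \<Rightarrow> 'a set \<Rightarrow> 'b set \<Rightarrow> 'a min_problem \<Rightarrow> bool" where
  "max_form B C1 C2 P \<longleftrightarrow>
     linear B \<and>
     bounded C1 \<and> closed C1 \<and> convex C1 \<and>
     bounded C2 \<and> closed C2 \<and> convex C2 \<and>
     feasible P = C1 \<and>
     (\<forall>u. is_maximum (objective P u) (\<lambda>w. B u \<bullet> w) C2)"

text \<open>\<open>Q\<close> is the Nesterov smoothing, with parameter \<open>\<mu>\<close>, of the problem \<open>P\<close> written in the above
  form by means of \<open>B\<close>, \<open>C1\<close>, \<open>C2\<close>. It is determined uniquely by \<open>\<mu>\<close>, \<open>B\<close>, \<open>C1\<close>, \<open>C2\<close>.\<close>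

definition is_nesterov_smoothing ::
  "real \<Rightarrow> ('a::euclidean_space \<Rightarrow> 'b::euclidean_space) \<Rightarrow> 'a set \<Rightarrow> 'b set \<Rightarrow>
   'a min_problem \<Rightarrow> 'a min_problem \<Rightarrow> bool" where
  "is_nesterov_smoothing \<mu> B C1 C2 P Q \<longleftrightarrow>
     \<mu> > 0 \<and> max_form B C1 C2 P \<and>
     feasible Q = C1 \<and>
     (\<forall>u. is_maximum (objective Q u) (\<lambda>w. B u \<bullet> w - \<mu> / 2 * (norm w)\<^sup>2) C2)"

lemma is_nesterov_smoothing_unique:
  assumes "is_nesterov_smoothing \<mu> B C1 C2 P Q" "is_nesterov_smoothing \<mu> B C1 C2 P Q'"
  shows "Q = Q'"
proof (rule min_problem.expand, intro conjI ext)
  show "feasible Q = feasible Q'"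
    using assms by (simp add: is_nesterov_smoothing_def)
  show "objective Q u = objective Q' u" for u
    using assms unfolding is_nesterov_smoothing_def is_maximum_def by (metis order_antisym)
qed

definition huber :: "real \<Rightarrow> real^3 \<Rightarrow> real" where
  "huber \<mu> v = (if norm v \<ge> \<mu> then norm v - \<mu> / 2 else (norm v)\<^sup>2 / (2 * \<mu>))"

definition dual_ball :: "('n1::finite, 'n2::finite, 'k::finite) vector_array set" where
  "dual_ball = {w. \<forall>i j k. norm (w $ i $ j $ k) \<le> 1}"

definition tv_ulog_problem ::
  "(('n1::finite, 'n2::finite, 'k::finite) scalar_array \<Rightarrow> ('n1, 'n2, 'k) vector_array) \<Rightarrow>
   ('n1, 'n2, 'k) scalar_array \<Rightarrow> ('n1, 'n2, 'k) scalar_array \<Rightarrow>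
   ('n1, 'n2, 'k) scalar_array min_problem" where
  "tv_ulog_problem A ulow uupp =
     Minimize (\<lambda>u. \<Sum>i\<in>UNIV. \<Sum>j\<in>UNIV. \<Sum>k\<in>UNIV. norm (A u $ i $ j $ k)) {ulow..uupp}"

definition huber_ulog_problem ::
  "real \<Rightarrow> (('n1::finite, 'n2::finite, 'k::finite) scalar_array \<Rightarrow> ('n1, 'n2, 'k) vector_array) \<Rightarrow>
   ('n1, 'n2, 'k) scalar_array \<Rightarrow> ('n1, 'n2, 'k) scalar_array \<Rightarrow>
   ('n1, 'n2, 'k) scalar_array min_problem" where
  "huber_ulog_problem \<mu> A ulow uupp =
     Minimize (\<lambda>u. \<Sum>i\<in>UNIV. \<Sum>j\<in>UNIV. \<Sum>k\<in>UNIV. huber \<mu> (A u $ i $ j $ k)) {ulow..uupp}"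

end

theory Submission imports Defs begin

text \<open>
  The dual ball is a product of unit balls of \<open>\<real>\<^sup>3\<close> and the objective \<open>\<langle>Au, w\<rangle> - \<mu>/2 \<parallel>w\<parallel>\<^sup>2\<close> is a sum
  of terms each depending on a single \<open>w\<^sub>i\<^sub>j\<^sub>k\<close>, so it is maximized entry by entry. For one entry,
  Cauchy-Schwarz reduces the problem to maximizing \<open>\<parallel>v\<parallel>s - \<mu>/2 s\<^sup>2\<close> over \<open>s \<in> [0, 1]\<close>: the maximizer
  is \<open>s = min (\<parallel>v\<parallel>/\<mu>) 1\<close>, with the Huber loss as value.
\<close>

text \<open>The boundary conventions only re-index entries of \<open>u\<close>, so each output entry
  is a fixed linear combination of entries.\<close>

lemma linear_scale_laplacian: "linear (scale_laplacian h1 h2 t)"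
  by (rule linearI)
    (auto simp: scale_laplacian_def vec_eq_iff Let_def field_simps add_divide_distrib diff_divide_distrib)

lemma linear_scale_gradient: "linear (scale_gradient h1 h2 b t)"
  by (rule linearI)
    (auto simp: scale_gradient_def vec_eq_iff forall_3 Let_def algebra_simps
      add_divide_distrib diff_divide_distrib)

lemma linear_ulog_op: "linear (ulog_op h1 h2 b t)"
  using linear_compose[OF linear_scale_laplacian linear_scale_gradient]
  unfolding ulog_op_def o_def .

text \<open>The constraint set is a product, so maximizers chosen separately for each index assemble
  into one feasible vector.\<close>

lemma is_maximum_sum_vec:
  fixes f :: "'n::finite \<Rightarrow> 'a \<Rightarrow> real"
  assumes "\<And>i. is_maximum (y i) (f i) (S i)"
  shows "is_maximum (\<Sum>i\<in>UNIV. y i) (\<lambda>w. \<Sum>i\<in>UNIV. f i (w $ i)) {w. \<forall>i. w $ i \<in> S i}"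
proof -
  have "\<forall>i. \<exists>x. x \<in> S i \<and> f i x = y i"
    using assms unfolding is_maximum_def by blast
  then obtain x where "\<forall>i. x i \<in> S i \<and> f i (x i) = y i"
    by metis
  then have "(\<chi> i. x i) \<in> {w. \<forall>i. w $ i \<in> S i}" "(\<Sum>i\<in>UNIV. f i ((\<chi> i. x i) $ i)) = (\<Sum>i\<in>UNIV. y i)"
    by auto
  moreover have "(\<Sum>i\<in>UNIV. f i (w $ i)) \<le> (\<Sum>i\<in>UNIV. y i)" if "\<forall>i. w $ i \<in> S i" for w
    using assms that unfolding is_maximum_def by (intro sum_mono) blast
  ultimately show ?thesis
    unfolding is_maximum_def by blast
qed

text \<open>The case \<open>\<mu> = 0\<close> is included because it is the one for the unsmoothed problem.\<close>

lemma is_maximum_huber: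
  assumes "\<mu> \<ge> 0"
  shows "is_maximum (huber \<mu> v) (\<lambda>w. v \<bullet> w - \<mu> / 2 * (norm w)\<^sup>2) (cball 0 1)"
proof -
  have bound: "v \<bullet> w - \<mu> / 2 * (norm w)\<^sup>2 \<le> huber \<mu> v" if "norm w \<le> 1" for w
  proof -
    have *: "v \<bullet> w \<le> norm v * norm w"
      by (rule norm_cauchy_schwarz)
    show ?thesis
    proof (cases "norm v \<ge> \<mu>")
      case True
      \<comment> \<open>With s = \<open>norm w\<close>, the gap between
        \<open>norm v - \<mu> / 2\<close> and \<open>norm v * s - \<mu> / 2 * s\<^sup>2\<close> has
        the root s = 1; this bound makes the cofactor nonnegative.\<close>
      have "\<mu> * (1 + norm w) \<le> \<mu> * 2"
        using assms that by (intro mult_left_mono) auto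
      then have "0 \<le> (1 - norm w) * (norm v - \<mu> / 2 * (1 + norm w))"
        using that True by (intro mult_nonneg_nonneg) auto
      also have "\<dots> = norm v - \<mu> / 2 - norm v * norm w + \<mu> / 2 * (norm w)\<^sup>2"
        by (simp add: field_simps power2_eq_square)
      finally show ?thesis
        using * True by (simp add: huber_def)
    next
      case False
      then have "\<mu> > 0"
        using assms by (cases "\<mu> = 0") auto
      \<comment> \<open>Completing the square in \<open>norm w\<close>.\<close>
      have "0 \<le> (norm v - \<mu> * norm w)\<^sup>2 / (2 * \<mu>)"
        using \<open>\<mu> > 0\<close> by simp
      also have "\<dots> = (norm v)\<^sup>2 / (2 * \<mu>) - norm v * norm w + \<mu> / 2 * (norm w)\<^sup>2"
        using \<open>\<mu> > 0\<close> by (simp add: field_simps power2_eq_square)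
      finally show ?thesis
        using * False by (simp add: huber_def)
    qed
  qed
  have "\<exists>w\<in>cball 0 1. v \<bullet> w - \<mu> / 2 * (norm w)\<^sup>2 = huber \<mu> v"
  proof (cases "norm v \<ge> \<mu>")
    case True
    \<comment> \<open>The maximizer is the unit vector along \<open>v\<close>. If
      \<open>v = 0\<close>, then \<open>sgn v = 0\<close> and the case assumption forces
      \<open>\<mu> = 0\<close>.\<close>
    have "v \<bullet> sgn v = norm v"
      by (cases "v = 0") (simp_all add: sgn_div_norm dot_square_norm power2_eq_square)
    then have "v \<bullet> sgn v - \<mu> / 2 * (norm (sgn v))\<^sup>2 = huber \<mu> v"
      using True assms by (auto simp: huber_def norm_sgn)
    moreover have "sgn v \<in> cball 0 1"
      by (simp add: norm_sgn)
    ultimately show ?thesis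
      by blast
  next
    case False
    then have "\<mu> > 0"
      using assms by (cases "\<mu> = 0") auto
    \<comment> \<open>The unconstrained maximizer \<open>v /\<^sub>R \<mu>\<close> lies in the ball,
      since \<open>norm v < \<mu>\<close>.\<close>
    have "v \<bullet> (v /\<^sub>R \<mu>) - \<mu> / 2 * (norm (v /\<^sub>R \<mu>))\<^sup>2 = huber \<mu> v"
      using False \<open>\<mu> > 0\<close> by (simp add: huber_def dot_square_norm field_simps power2_eq_square)
    moreover have "v /\<^sub>R \<mu> \<in> cball 0 1"
      using False \<open>\<mu> > 0\<close> by (simp add: field_simps)
    ultimately show ?thesis
      by blast
  qed
  then show ?thesis
    using bound unfolding is_maximum_def by auto
qed

lemma norm_vec_power2:
  fixes w :: "('a::real_inner, 'n::finite) vec"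
  shows "(norm w)\<^sup>2 = (\<Sum>i\<in>UNIV. (norm (w $ i))\<^sup>2)"
  by (simp add: power2_norm_eq_inner inner_vec_def)

lemma is_maximum_huber_array:
  fixes v :: "('n1::finite, 'n2::finite, 'k::finite) vector_array"
  assumes "\<mu> \<ge> 0"
  shows "is_maximum (\<Sum>i\<in>UNIV. \<Sum>j\<in>UNIV. \<Sum>k\<in>UNIV. huber \<mu> (v $ i $ j $ k))
    (\<lambda>w. v \<bullet> w - \<mu> / 2 * (norm w)\<^sup>2) dual_ball"
proof -
  \<comment> \<open>Writing the dual ball as a nested product lets the sum rule apply once per
    index.\<close>
  have "is_maximum (\<Sum>i\<in>UNIV. \<Sum>j\<in>UNIV. \<Sum>k\<in>UNIV. huber \<mu> (v $ i $ j $ k))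
    (\<lambda>w. \<Sum>i\<in>UNIV. \<Sum>j\<in>UNIV. \<Sum>k\<in>UNIV. v $ i $ j $ k \<bullet> w $ i $ j $ k
       - \<mu> / 2 * (norm (w $ i $ j $ k))\<^sup>2)
    {w. \<forall>i. w $ i \<in> {w. \<forall>j. w $ j \<in> {w. \<forall>k. w $ k \<in> cball 0 1}}}"
    by (intro is_maximum_sum_vec is_maximum_huber assms)
  then show ?thesis
    by (simp add: dual_ball_def inner_vec_def norm_vec_power2 sum_subtractf sum_distrib_left)
qed

text \<open>As an intersection of preimages under continuous linear maps, the set inherits
  closedness and convexity from \<open>cball 0 1\<close>.\<close>

lemma dual_ball_eq_INT: "dual_ball = (\<Inter>i j k. (\<lambda>w. w $ i $ j $ k) -` cball 0 1)"
  by (auto simp: dual_ball_def)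

lemma closed_dual_ball: "closed dual_ball"
  unfolding dual_ball_eq_INT
  by (intro closed_INT ballI closed_vimage closed_cball continuous_intros)

lemma convex_dual_ball: "convex dual_ball"
  unfolding dual_ball_eq_INT
  by (intro convex_INT convex_linear_vimage convex_cball linearI) auto

text \<open>Each entry contributes at most 1 to the squared norm.\<close>

lemma bounded_dual_ball:
  "bounded (dual_ball :: ('n1::finite, 'n2::finite, 'k::finite) vector_array set)"
proof (rule boundedI)
  fix w :: "('n1, 'n2, 'k) vector_array"
  assume "w \<in> dual_ball"
  then have "(norm w)\<^sup>2 \<le> (\<Sum>i\<in>(UNIV :: 'n1 set). \<Sum>j\<in>(UNIV :: 'n2 set). \<Sum>k\<in>(UNIV :: 'k set). 1)"
    unfolding norm_vec_power2[of w] norm_vec_power2[of "w $ i" for i] norm_vec_power2[of "w $ i $ j" for i j]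
    by (intro sum_mono) (simp add: dual_ball_def power_le_one)
  then show "norm w \<le> sqrt (\<Sum>i\<in>(UNIV :: 'n1 set). \<Sum>j\<in>(UNIV :: 'n2 set). \<Sum>k\<in>(UNIV :: 'k set). 1)"
    by (rule real_le_rsqrt)
qed

theorem proposition3:
  fixes ulow uupp :: "('n1::{finite,linorder}, 'n2::{finite,linorder}, 'k::{finite,linorder}) scalar_array"
    and h1 h2 b \<mu> :: real
    and t :: "nat \<Rightarrow> real"
  assumes "CARD('n1) \<ge> 2" and "CARD('n2) \<ge> 2"
    and "h1 > 0" and "h2 > 0"
    and "b > 1"
    and "\<forall>k\<in>{1..CARD('k)}. t k > 0"
    and "strict_mono_on {1..CARD('k)} t"
    and "\<forall>k\<in>{1..<CARD('k)}. t (k + 1) = b * t k"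
    and "ulow \<le> uupp"
    and "\<mu> > 0"
  shows "is_nesterov_smoothing \<mu> (ulog_op h1 h2 b t) {ulow..uupp} dual_ball
           (tv_ulog_problem (ulog_op h1 h2 b t) ulow uupp)
           (huber_ulog_problem \<mu> (ulog_op h1 h2 b t) ulow uupp)"
proof -
  have "bounded {ulow..uupp}" "closed {ulow..uupp}" "convex {ulow..uupp}"
    by (simp_all flip: interval_cbox)
  moreover have "is_maximum (\<Sum>i\<in>UNIV. \<Sum>j\<in>UNIV. \<Sum>k\<in>UNIV. norm (v $ i $ j $ k)) (\<lambda>w. v \<bullet> w) dual_ball"
    for v :: "('n1, 'n2, 'k) vector_array"
    \<comment> \<open>At \<open>\<mu> = 0\<close> the Huber loss is the norm and the quadratic term
      vanishes.\<close>
    using is_maximum_huber_array[of 0 v] by (simp add: huber_def)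
  ultimately show ?thesis
    using \<open>\<mu> > 0\<close>
    by (simp add: is_nesterov_smoothing_def max_form_def tv_ulog_problem_def huber_ulog_problem_def
        linear_ulog_op closed_dual_ball convex_dual_ball bounded_dual_ball is_maximum_huber_array
        del: times_divide_eq_left)
qed

end
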